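(* Let $G$ be a graph with minimum degree at least $2$. If $\chi'_{\mathrm{inj}}(G)=k$, then $\chi_{st}(G)\leq 2^k-1$.
   Context: All graphs are finite and simple. A star coloring of $G$ is a proper vertex coloring of $G$ such that the union of any two color classes induces a star forest in $G$, i.e. every component of the induced subgraph is a star. The star chromatic number $\chi_{st}(G)$ is the smallest integer $k$ for which $G$ admits a star coloring with $k$ colors. Three edges $e_1,e_2,e_3$ of a graph are consecutive if they form (in this order) a path of length three or a cycle of length three. An injective edge-coloring of $G$ with $k$ colors is a map $c:E(G)\to\{1,\dots,k\}$ (not necessarily a proper edge-coloring) such that $c(e_1)\neq c(e_3)$ whenever $e_1,e_2,e_3$ are consecutive edges in $G$. The injective chromatic index $\chi'_{\mathrm{inj}}(G)$ is the minimum $k$ such that $G$ has an injective edge-coloring with $k$ colors. *)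

theory Defs
  imports "HOL-Library.Extended_Nat" "HOL-Library.FuncSet"
begin

text \<open>
  A graph is given by its vertex set \<open>V\<close> and its edge set \<open>E\<close>, edges being two-element
  subsets of \<open>V\<close>. The empty graph is allowed.
\<close>

locale fin_simple_graph =
  fixes V :: "'a set" and E :: "'a set set"
  assumes finite_verts: "finite V"
    and edges: "\<And>e. e \<in> E \<Longrightarrow> e \<subseteq> V \<and> card e = 2"

definition degree :: "'a set set \<Rightarrow> 'a \<Rightarrow> nat" where
  "degree E v = card {e \<in> E. v \<in> e}"

text \<open>The infimum is taken in \<open>enat\<close> so that the empty graph has minimum degree \<open>\<infinity>\<close>.\<close>

definition min_degree :: "'a set \<Rightarrow> 'a set set \<Rightarrow> enat" where
  "min_degree V E = (INF v\<in>V. enat (degree E v))"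

definition induced_edges :: "'a set set \<Rightarrow> 'a set \<Rightarrow> 'a set set" where
  "induced_edges E S = {e \<in> E. e \<subseteq> S}"

definition adj :: "'a set set \<Rightarrow> ('a \<times> 'a) set" where
  "adj E = {(u, v). {u, v} \<in> E}"

definition components :: "'a set \<Rightarrow> 'a set set \<Rightarrow> 'a set set" where
  "components V E = {{w \<in> V. (v, w) \<in> (adj E)\<^sup>*} | v. v \<in> V}"

text \<open>A single vertex without edges is the star with no leaves.\<close>

definition is_star :: "'a set \<Rightarrow> 'a set set \<Rightarrow> bool" where
  "is_star V E \<longleftrightarrow> (\<exists>z\<in>V. E = {{z, v} | v. v \<in> V - {z}})"

definition star_forest :: "'a set \<Rightarrow> 'a set set \<Rightarrow> bool" where
  "star_forest V E \<longleftrightarrow> (\<forall>C\<in>components V E. is_star C (induced_edges E C))"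

definition proper_coloring :: "'a set \<Rightarrow> 'a set set \<Rightarrow> nat \<Rightarrow> ('a \<Rightarrow> nat) \<Rightarrow> bool" where
  "proper_coloring V E k c \<longleftrightarrow>
     c \<in> V \<rightarrow> {1..k} \<and> (\<forall>u\<in>V. \<forall>v\<in>V. {u, v} \<in> E \<longrightarrow> c u \<noteq> c v)"

definition color_class :: "'a set \<Rightarrow> ('a \<Rightarrow> nat) \<Rightarrow> nat \<Rightarrow> 'a set" where
  "color_class V c i = {v \<in> V. c v = i}"

definition star_coloring :: "'a set \<Rightarrow> 'a set set \<Rightarrow> nat \<Rightarrow> ('a \<Rightarrow> nat) \<Rightarrow> bool" where
  "star_coloring V E k c \<longleftrightarrow>
     proper_coloring V E k c \<and>
     (\<forall>i\<in>{1..k}. \<forall>j\<in>{1..k}. i \<noteq> j \<longrightarrow>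
        (let S = color_class V c i \<union> color_class V c j
         in star_forest S (induced_edges E S)))"

definition star_chromatic_number :: "'a set \<Rightarrow> 'a set set \<Rightarrow> nat" where
  "star_chromatic_number V E = (LEAST k. \<exists>c. star_coloring V E k c)"

definition consecutive :: "'a set set \<Rightarrow> 'a set \<Rightarrow> 'a set \<Rightarrow> 'a set \<Rightarrow> bool" where
  "consecutive E e1 e2 e3 \<longleftrightarrow>
     {e1, e2, e3} \<subseteq> E \<and>
     ((\<exists>x y z w. distinct [x, y, z, w] \<and> e1 = {x, y} \<and> e2 = {y, z} \<and> e3 = {z, w}) \<or>
      (\<exists>x y z. distinct [x, y, z] \<and> e1 = {x, y} \<and> e2 = {y, z} \<and> e3 = {z, x}))"

definition injective_edge_coloring :: "'a set set \<Rightarrow> nat \<Rightarrow> ('a set \<Rightarrow> nat) \<Rightarrow> bool" where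
  "injective_edge_coloring E k c \<longleftrightarrow>
     c \<in> E \<rightarrow> {1..k} \<and> (\<forall>e1 e2 e3. consecutive E e1 e2 e3 \<longrightarrow> c e1 \<noteq> c e3)"

definition injective_chromatic_index :: "'a set set \<Rightarrow> nat" where
  "injective_chromatic_index E = (LEAST k. \<exists>c. injective_edge_coloring E k c)"

text \<open>For finite simple graphs both minima range over a nonempty set.\<close>

lemma (in fin_simple_graph) injective_edge_coloring_exists:
  "\<exists>k c. injective_edge_coloring E k c"
proof -
  have "finite E"
    by (rule finite_subset[of _ "Pow V"]) (use edges finite_verts in auto)
  then obtain c where c: "bij_betw c E {1..card E}"
    using ex_bij_betw_finite_nat[of E] bij_betw_iff_card[of E "{1..card E}"] by auto
  have inE: "e1 \<in> E \<and> e3 \<in> E" if "consecutive E e1 e2 e3" for e1 e2 e3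
    using that unfolding consecutive_def by simp
  have neq: "e1 \<noteq> e3" if "consecutive E e1 e2 e3" for e1 e2 e3
    using that unfolding consecutive_def by (auto simp: doubleton_eq_iff)
  have "injective_edge_coloring E (card E) c"
    unfolding injective_edge_coloring_def
    using neq inE bij_betw_apply[OF c] inj_on_eq_iff[OF bij_betw_imp_inj_on[OF c]]
    by (metis Pi_I)
  then show ?thesis by blast
qed

lemma (in fin_simple_graph) star_coloring_exists:
  "\<exists>k c. star_coloring V E k c"
proof -
  obtain c where c: "bij_betw c V {1..card V}"
    using finite_verts bij_betw_iff_card[of V "{1..card V}"] by auto
  have noloop: "{v} \<notin> E" for v
    using edges[of "{v}"] by auto
  have proper: "proper_coloring V E (card V) c"
    unfolding proper_coloring_def
    using noloop bij_betw_apply[OF c] inj_on_eq_iff[OF bij_betw_imp_inj_on[OF c]]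
    by (metis Pi_I insert_absorb2)
  have star: "star_forest S (induced_edges E S)"
    if ij: "i \<in> {1..card V}" "j \<in> {1..card V}" "i \<noteq> j"
      and S: "S = color_class V c i \<union> color_class V c j" for i j S
  proof -
    have "i \<in> c ` V" "j \<in> c ` V"
      unfolding bij_betw_imp_surj_on[OF c] by (rule ij)+
    then obtain a b where a: "a \<in> V" "c a = i" and b: "b \<in> V" "c b = j" by blast
    have Sab: "S = {a, b}"
      using a b inj_on_eq_iff[OF bij_betw_imp_inj_on[OF c]] unfolding S color_class_def by blast
    have ab: "a \<noteq> b" using a b ij(3) by auto
    have two: "e = {a, b}" if "e \<in> E" "e \<subseteq> {a, b}" for e
      using that edges[of e] ab by (intro card_subset_eq) auto
    show ?thesis
    proof (cases "{a, b} \<in> E")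
      case True
      then have ind: "induced_edges E S = {{a, b}}"
        using two unfolding induced_edges_def Sab by auto
      have "(a, b) \<in> adj {{a, b}}" "(b, a) \<in> adj {{a, b}}"
        unfolding adj_def by auto
      then have "{w \<in> {a, b}. (v, w) \<in> (adj {{a, b}})\<^sup>*} = {a, b}" if "v \<in> {a, b}" for v
        using that by blast
      then have "C = {a, b}" if "C \<in> components S {{a, b}}" for C
        using that unfolding components_def Sab by blast
      moreover have "is_star {a, b} (induced_edges {{a, b}} {a, b})"
        unfolding is_star_def induced_edges_def using ab by auto
      ultimately show ?thesis unfolding star_forest_def ind by blast
    next
      case False
      then have ind: "induced_edges E S = {}"
        using two unfolding induced_edges_def Sab by auto
      have "adj ({} :: 'a set set) = {}" unfolding adj_def by auto
      then have "\<exists>v. C = {v}" if "C \<in> components S {}" for C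
        using that unfolding components_def by auto
      moreover have "is_star {v} (induced_edges {} {v})" for v :: 'a
        unfolding is_star_def induced_edges_def by auto
      ultimately show ?thesis unfolding star_forest_def ind by blast
    qed
  qed
  show ?thesis
    using proper star unfolding star_coloring_def Let_def by blast
qed

end

(* Given an injective edge-coloring with k colors, color each vertex v by the set S(v) of colors
   of the edges at v.  Minimum degree at least 2 makes this a star coloring by nonempty subsets
   of {1..k}: for a path x, y, z, w with S(x) = S(z) and S(y) = S(w), injectivity at the middle
   edge forces the color of xy, which occurs at z, and that of zw, which occurs at y, to equal
   the color of yz, whereas xy and zw must have different colors. *)

theory Submission imports Defs begin

text \<open>In each component some vertex \<open>z\<close> has neighbors with no neighbor but
  \<open>z\<close>. Then \<open>z\<close> together with its neighbors is closed under adjacency,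
  hence is the whole component, and all its edges meet \<open>z\<close>.\<close>

lemma star_forest_no_P4_no_C3:
  assumes FS: "\<And>x y. {x, y} \<in> F \<Longrightarrow> x \<in> S \<and> y \<in> S \<and> x \<noteq> y"
    and pairs: "\<And>e. e \<in> F \<Longrightarrow> \<exists>x y. e = {x, y}"
    and noP4: "\<And>x y z w. distinct [x, y, z, w] \<Longrightarrow> {x, y} \<in> F \<Longrightarrow> {y, z} \<in> F \<Longrightarrow> {z, w} \<in> F \<Longrightarrow> False"
    and noC3: "\<And>x y z. {x, y} \<in> F \<Longrightarrow> {y, z} \<in> F \<Longrightarrow> {z, x} \<in> F \<Longrightarrow> False"
  shows "star_forest S F"
  unfolding star_forest_def
proof
  fix C assume "C \<in> components S F"
  then obtain v where v: "v \<in> S" and C: "C = {w \<in> S. (v, w) \<in> (adj F)\<^sup>*}"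
    unfolding components_def by blast
  have comm: "{x, y} \<in> F \<Longrightarrow> {y, x} \<in> F" for x y by (simp add: insert_commute)
  \<comment> \<open>A center: either \<open>v\<close> itself, or else a neighbor of \<open>v\<close> of degree at least 2.\<close>
  obtain z where z: "z \<in> C" and center: "\<And>n m. {z, n} \<in> F \<Longrightarrow> {n, m} \<in> F \<Longrightarrow> m = z"
  proof (cases "\<forall>n m. {v, n} \<in> F \<longrightarrow> {n, m} \<in> F \<longrightarrow> m = v")
    case True
    with v C that[of v] show ?thesis by blast
  next
    case False
    then obtain n m where nm: "{v, n} \<in> F" "{n, m} \<in> F" "m \<noteq> v" by blast
    have "m' = n" if "{n, n'} \<in> F" "{n', m'} \<in> F" for n' m'
    proof (rule ccontr)
      assume "m' \<noteq> n"
      \<comment> \<open>\<open>n\<close> has the two distinct neighbors \<open>v\<close> and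
        \<open>m\<close>, so one of them differs from \<open>n'\<close>. It extends the path
        \<open>n\<close>, \<open>n'\<close>, \<open>m'\<close> backwards, or closes a triangle if it
        equals \<open>m'\<close>.\<close>
      obtain p where p: "{n, p} \<in> F" "p \<noteq> n'" using nm comm by metis
      show False
      proof (cases "m' = p")
        case True
        then show False using noC3[of n n' p] that p comm by blast
      next
        case False
        have "distinct [m', n', n, p]"
          using False \<open>m' \<noteq> n\<close> p FS[OF that(1)] FS[OF that(2)] FS[OF p(1)] by auto
        then show False using noP4 that p comm by blast
      qed
    qed
    moreover have "n \<in> C" using nm FS unfolding C adj_def by blast
    ultimately show ?thesis using that by blast
  qed
  have sym: "sym ((adj F)\<^sup>*)"
    by (intro sym_rtrancl symI) (auto simp: adj_def insert_commute)
  have zv: "(v, z) \<in> (adj F)\<^sup>*" and zS: "z \<in> S" using z C by auto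
  have reach: "w = z \<or> {z, w} \<in> F" if "(z, w) \<in> (adj F)\<^sup>*" for w
    using that
  proof induction
    case (step y w)
    then show ?case using center unfolding adj_def by blast
  qed simp
  have CF: "w \<in> C \<longleftrightarrow> w = z \<or> {z, w} \<in> F" for w
  proof
    assume "w \<in> C"
    then have "(z, w) \<in> (adj F)\<^sup>*"
      using zv sym unfolding C by (blast dest: symD intro: rtrancl_trans)
    then show "w = z \<or> {z, w} \<in> F" by (rule reach)
  next
    assume "w = z \<or> {z, w} \<in> F"
    then show "w \<in> C"
      using zS zv FS rtrancl_into_rtrancl[OF zv, of w] unfolding C adj_def by blast
  qed
  have "induced_edges F C = {{z, v} |v. v \<in> C - {z}}"
  proof (intro equalityI subsetI)
    fix e assume "e \<in> induced_edges F C"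
    then have "e \<in> F" "e \<subseteq> C" unfolding induced_edges_def by auto
    with pairs obtain x y where e: "e = {x, y}" by blast
    have xy: "{x, y} \<in> F" "x \<in> C" "y \<in> C" using \<open>e \<in> F\<close> \<open>e \<subseteq> C\<close> e by auto
    \<comment> \<open>If \<open>x\<close> is not \<open>z\<close>, it is a neighbor of
      \<open>z\<close>, and \<open>center\<close> makes its neighbor \<open>y\<close> equal to
      \<open>z\<close>.\<close>
    have "x = z \<or> y = z" using center[of x y] CF[of x] xy by auto
    then obtain u where "u \<in> C" "e = {z, u}" using e xy by (auto simp: insert_commute)
    moreover have "u \<noteq> z" using FS[of z u] \<open>e \<in> F\<close> \<open>e = {z, u}\<close> by blast
    ultimately show "e \<in> {{z, v} |v. v \<in> C - {z}}" by blast
  next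
    fix e assume "e \<in> {{z, v} |v. v \<in> C - {z}}"
    then obtain u where "e = {z, u}" "u \<in> C" "u \<noteq> z" by blast
    then show "e \<in> induced_edges F C" using CF[of u] z unfolding induced_edges_def by blast
  qed
  then show "is_star C (induced_edges F C)" unfolding is_star_def using z by blast
qed

context fin_simple_graph
begin

lemma edge_verts: "{x, y} \<in> E \<Longrightarrow> x \<in> V \<and> y \<in> V \<and> x \<noteq> y"
  using edges[of "{x, y}"] by auto

text \<open>Within two color classes a proper coloring alternates along edges. This rules out
  triangles and makes any path on four vertices satisfy the color equations in
  \<open>noP4\<close>.\<close>

lemma star_coloring_no_bicolored_P4:
  assumes proper: "proper_coloring V E k c"
    and noP4: "\<And>x y z w. distinct [x, y, z, w] \<Longrightarrow> {x, y} \<in> E \<Longrightarrow> {y, z} \<in> E \<Longrightarrow> {z, w} \<in> E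
      \<Longrightarrow> c x = c z \<Longrightarrow> c y = c w \<Longrightarrow> False"
  shows "star_coloring V E k c"
proof -
  have "star_forest S (induced_edges E S)"
    if S: "S = color_class V c i \<union> color_class V c j" for i j S
  proof (rule star_forest_no_P4_no_C3)
    have col: "c x = i \<or> c x = j" if "x \<in> S" for x
      using that unfolding S color_class_def by blast
    have edge: "{x, y} \<in> E \<and> x \<in> S \<and> y \<in> S \<and> c x \<noteq> c y" if "{x, y} \<in> induced_edges E S" for x y
      using that proper edge_verts unfolding induced_edges_def proper_coloring_def by blast
    show "x \<in> S \<and> y \<in> S \<and> x \<noteq> y" if "{x, y} \<in> induced_edges E S" for x y
      using edge[OF that] by blast
    show "\<exists>x y. e = {x, y}" if "e \<in> induced_edges E S" for e
      using that edges[of e] unfolding induced_edges_def card_2_iff by blast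
    show False if "distinct [x, y, z, w]" "{x, y} \<in> induced_edges E S"
      "{y, z} \<in> induced_edges E S" "{z, w} \<in> induced_edges E S" for x y z w
    proof (rule noP4[OF that(1)])
      show "c x = c z" "c y = c w"
        using edge[OF that(2)] edge[OF that(3)] edge[OF that(4)] col by metis+
    qed (use edge that in blast)+
    show False if "{x, y} \<in> induced_edges E S"
      "{y, z} \<in> induced_edges E S" "{z, x} \<in> induced_edges E S" for x y z
      using edge[OF that(1)] edge[OF that(2)] edge[OF that(3)] col by metis
  qed
  then show ?thesis using proper unfolding star_coloring_def Let_def by blast
qed

text \<open>Of the at least two edges at \<open>v\<close>, at most one is \<open>{v, u}\<close>. As
  \<open>u\<close> is arbitrary, this also yields a mere neighbor.\<close>

lemma obtain_second_neighbor:
  assumes "min_degree V E \<ge> 2" "v \<in> V"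
  obtains w where "{v, w} \<in> E" "w \<noteq> u"
proof -
  have "min_degree V E \<le> enat (degree E v)"
    unfolding min_degree_def by (rule INF_lower[OF assms(2)])
  then have deg: "2 \<le> degree E v"
    using assms(1) by (metis enat_ord_simps(1) numeral_eq_enat order_trans)
  have "\<not> {e \<in> E. v \<in> e} \<subseteq> {{v, u}}"
    using deg card_mono[of "{{v, u}}" "{e \<in> E. v \<in> e}"] unfolding degree_def by auto
  then obtain e where e: "e \<in> E" "v \<in> e" "e \<noteq> {v, u}" by blast
  then obtain w where "e = {v, w}" using edges[of e] by (auto simp: card_2_iff)
  with e that show ?thesis by blast
qed

text \<open>The vertices \<open>x\<close> and \<open>w\<close> may coincide: that is the triangle
  case of \<open>consecutive\<close>, so later arguments need no case split.\<close>

lemma injective_edge_coloring_neq: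
  assumes "injective_edge_coloring E k c"
    and "{x, y} \<in> E" "{y, z} \<in> E" "{z, w} \<in> E" "x \<noteq> z" "y \<noteq> w"
  shows "c {x, y} \<noteq> c {z, w}"
proof -
  have "consecutive E {x, y} {y, z} {z, w}"
  proof (cases "x = w")
    case True
    have "distinct [x, y, z]" using assms edge_verts by auto
    with True show ?thesis unfolding consecutive_def using assms by blast
  next
    case False
    have "distinct [x, y, z, w]"
      using False assms edge_verts[of x y] edge_verts[of y z] edge_verts[of z w] by auto
    then show ?thesis unfolding consecutive_def using assms by blast
  qed
  then show ?thesis using assms(1) unfolding injective_edge_coloring_def by blast
qed

definition incident_colors :: "('a set \<Rightarrow> nat) \<Rightarrow> 'a \<Rightarrow> nat set" where
  "incident_colors c v = {c {v, w} |w. {v, w} \<in> E}"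

text \<open>An edge at \<open>z\<close> with the color of \<open>{x, y}\<close> must end in
  \<open>y\<close>, since otherwise injectivity across \<open>{y, z}\<close> is violated.\<close>

lemma shared_color_eq_middle:
  assumes "injective_edge_coloring E k c"
    and "{x, y} \<in> E" "{y, z} \<in> E" "x \<noteq> z" "c {x, y} \<in> incident_colors c z"
  shows "c {x, y} = c {y, z}"
proof -
  obtain w where "{z, w} \<in> E" "c {x, y} = c {z, w}"
    using assms(5) unfolding incident_colors_def by blast
  then have "w = y" using injective_edge_coloring_neq[OF assms(1-3)] assms(4) by metis
  then show ?thesis using \<open>c {x, y} = c {z, w}\<close> by (simp add: insert_commute)
qed

text \<open>Excluding the empty set accounts for the \<open>- 1\<close> in the bound.\<close>

lemma incident_colors_nonempty_subset:
  assumes "min_degree V E \<ge> 2" "injective_edge_coloring E k c" "v \<in> V"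
  shows "incident_colors c v \<in> Pow {1..k} - {{}}"
proof -
  obtain w where "{v, w} \<in> E" using obtain_second_neighbor[OF assms(1,3)] by blast
  then have "incident_colors c v \<noteq> {}" unfolding incident_colors_def by blast
  moreover have "incident_colors c v \<subseteq> {1..k}"
    using assms(2) unfolding incident_colors_def injective_edge_coloring_def by blast
  ultimately show ?thesis by blast
qed

text \<open>Both outer edges are forced to the color of the middle one, yet must differ. Assuming
  two memberships rather than equal color sets, and allowing \<open>x = w\<close>, lets this serve
  both properness and the exclusion of bicolored paths.\<close>

lemma incident_colors_bicolored_P4:
  assumes inj: "injective_edge_coloring E k c"
    and path: "{x, y} \<in> E" "{y, z} \<in> E" "{z, w} \<in> E" "x \<noteq> z" "y \<noteq> w"
    and "c {x, y} \<in> incident_colors c z" "c {z, w} \<in> incident_colors c y"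
  shows False
proof -
  have "c {x, y} = c {y, z}"
    using shared_color_eq_middle[OF inj] path assms(7) by blast
  \<comment> \<open>The same argument with the path read backwards.\<close>
  moreover have "c {w, z} = c {z, y}"
    using shared_color_eq_middle[OF inj, of w z y] path assms(8) by (simp add: insert_commute)
  ultimately show False
    using injective_edge_coloring_neq[OF inj path] by (simp add: insert_commute)
qed

text \<open>The degree bound extends the edge at both ends to \<open>x\<close>, \<open>u\<close>,
  \<open>v\<close>, \<open>w\<close>; equal sets at \<open>u\<close> and \<open>v\<close> put each
  outer color at the opposite middle vertex. A single edge as the whole graph would have equal sets
  at its ends.\<close>

lemma incident_colors_proper:
  assumes deg: "min_degree V E \<ge> 2" and inj: "injective_edge_coloring E k c"
    and uv: "{u, v} \<in> E"
  shows "incident_colors c u \<noteq> incident_colors c v"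
proof
  assume eq: "incident_colors c u = incident_colors c v"
  obtain x where x: "{u, x} \<in> E" "x \<noteq> v"
    using obtain_second_neighbor[OF deg] edge_verts[OF uv] by metis
  obtain w where w: "{v, w} \<in> E" "w \<noteq> u"
    using obtain_second_neighbor[OF deg] edge_verts[OF uv] by metis
  have "c {u, x} \<in> incident_colors c v" "c {v, w} \<in> incident_colors c u"
    using x w eq unfolding incident_colors_def by blast+
  then show False
    using incident_colors_bicolored_P4[OF inj, of x u v w] x w uv by (auto simp: insert_commute)
qed

lemma star_coloring_of_injective_edge_coloring:
  assumes deg: "min_degree V E \<ge> 2" and inj: "injective_edge_coloring E k c"
  shows "\<exists>f. star_coloring V E (2 ^ k - 1) f"
proof -
  let ?P = "Pow {1..k} - {{}}"
  \<comment> \<open>This holds for \<open>k = 0\<close> too, where both sides are 0.\<close>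
  have "card ?P = 2 ^ k - 1" by (simp add: card_Diff_singleton card_Pow)
  then obtain h where h: "bij_betw h ?P {1..2 ^ k - 1 :: nat}"
    using bij_betw_iff_card[of ?P "{1..2 ^ k - 1 :: nat}"] by auto
  define f where "f = h \<circ> incident_colors c"
  \<comment> \<open>The numbering \<open>h\<close> is injective only on \<open>?P\<close>, which
    contains the color sets of vertices in \<open>V\<close>.\<close>
  have f_eq: "f u = f v \<longleftrightarrow> incident_colors c u = incident_colors c v" if "u \<in> V" "v \<in> V" for u v
    unfolding f_def comp_def
    by (rule inj_on_eq_iff[OF bij_betw_imp_inj_on[OF h]
      incident_colors_nonempty_subset[OF deg inj that(1)]
      incident_colors_nonempty_subset[OF deg inj that(2)]])
  have "star_coloring V E (2 ^ k - 1) f"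
  proof (rule star_coloring_no_bicolored_P4)
    have "f \<in> V \<rightarrow> {1..2 ^ k - 1}"
      unfolding f_def comp_def
      by (intro Pi_I bij_betw_apply[OF h] incident_colors_nonempty_subset[OF deg inj])
    then show "proper_coloring V E (2 ^ k - 1) f"
      unfolding proper_coloring_def using f_eq incident_colors_proper[OF deg inj] by blast
  next
    fix x y z w
    assume path: "distinct [x, y, z, w]" "{x, y} \<in> E" "{y, z} \<in> E" "{z, w} \<in> E"
      and "f x = f z" "f y = f w"
    then have eq: "incident_colors c x = incident_colors c z" "incident_colors c y = incident_colors c w"
      using f_eq edge_verts by blast+
    have "c {x, y} \<in> incident_colors c x" "c {w, z} \<in> incident_colors c w"
      using path(2,4) unfolding incident_colors_def by (auto simp: insert_commute)
    then have "c {x, y} \<in> incident_colors c z" "c {z, w} \<in> incident_colors c y"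
      using eq by (simp_all add: insert_commute)
    then show False
      using incident_colors_bicolored_P4[OF inj path(2-4)] path(1) by auto
  qed
  then show ?thesis by blast
qed

end

theorem mainTheorem7:
  fixes V :: "'a set" and E :: "'a set set" and k :: nat
  assumes "fin_simple_graph V E"
    and "min_degree V E \<ge> 2"
    and "injective_chromatic_index E = k"
  shows "star_chromatic_number V E \<le> 2 ^ k - 1"
proof -
  interpret fin_simple_graph V E by (rule assms(1))
  \<comment> \<open>The minimum defining the index is attained because some injective edge-coloring
    exists.\<close>
  have "\<exists>c. injective_edge_coloring E k c"
    using LeastI_ex[OF injective_edge_coloring_exists] assms(3)
    unfolding injective_chromatic_index_def by simp
  then show ?thesis
    unfolding star_chromatic_number_def
    using star_coloring_of_injective_edge_coloring[OF assms(2)] by (blast intro: Least_le)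
qed

end
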